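(* Let $\mathcal{Q}$ be a generalised quadrangle of order $(s,t)$ with $s\geq t$. If $\mathcal{T}$ is an $x$-tight set of $\mathcal{Q}$ with $x\leq\frac{s}{t}+1$, then either $\mathcal{T}$ is the union of the point sets of $x$ pairwise disjoint lines, or $x=\frac{s}{t}+1$ and the points of $\mathcal{T}$ form (together with the lines containing $x$ of its points) a subquadrangle of $\mathcal{Q}$ of order $\left(\frac{s}{t},t\right)$.
   Context: A generalised quadrangle of order $(s,t)$, $s,t\geq 1$, is a point-line incidence geometry in which two distinct points lie on at most one common line, every line has $s+1$ points, every point lies on $t+1$ lines, and for every point $P$ and line $\ell$ not incident with $P$ there is a unique pair $(P',\ell')$ with $P$ on $\ell'$, $P'$ on $\ell$ and $P'$ on $\ell'$. For a point $P$, $P^{\perp}$ denotes the set of points collinear with $P$, including $P$. A point set $\mathcal{T}$ is an $x$-tight set if $|P^{\perp}\cap\mathcal{T}|=s+x$ for every $P\in\mathcal{T}$ and $|P^{\perp}\cap\mathcal{T}|=x$ for every point $P\notin\mathcal{T}$. *)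

theory Defs
  imports Complex_Main
begin

definition points_on :: "('p \<Rightarrow> 'l \<Rightarrow> bool) \<Rightarrow> 'p set \<Rightarrow> 'l \<Rightarrow> 'p set" where
  "points_on I A l = {p \<in> A. I p l}"

text \<open>
  The point set is required to be nonempty: the empty geometry satisfies all the other
  axioms vacuously. Finiteness follows from the axioms, since a set whose cardinality
  is a successor is finite.
\<close>

locale generalised_quadrangle =
  fixes points :: "'p set" and lines :: "'l set" and I :: "'p \<Rightarrow> 'l \<Rightarrow> bool"
    and s t :: nat
  assumes points_nonempty: "points \<noteq> {}"
    and s_ge_1: "s \<ge> 1"
    and t_ge_1: "t \<ge> 1"
    and common_line_unique:
      "\<lbrakk>p \<in> points; q \<in> points; p \<noteq> q; l \<in> lines; m \<in> lines; I p l; I q l; I p m; I q m\<rbrakk>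
        \<Longrightarrow> l = m"
    and card_points_on_line: "l \<in> lines \<Longrightarrow> card (points_on I points l) = s + 1"
    and card_lines_on_point: "p \<in> points \<Longrightarrow> card {l \<in> lines. I p l} = t + 1"
    and unique_projection:
      "\<lbrakk>p \<in> points; l \<in> lines; \<not> I p l\<rbrakk>
        \<Longrightarrow> \<exists>!(q, m). q \<in> points \<and> m \<in> lines \<and> I p m \<and> I q l \<and> I q m"

definition perp :: "'p set \<Rightarrow> 'l set \<Rightarrow> ('p \<Rightarrow> 'l \<Rightarrow> bool) \<Rightarrow> 'p \<Rightarrow> 'p set" where
  "perp points lines I p = insert p {q \<in> points. \<exists>l\<in>lines. I p l \<and> I q l}"

definition tight_set ::
    "'p set \<Rightarrow> 'l set \<Rightarrow> ('p \<Rightarrow> 'l \<Rightarrow> bool) \<Rightarrow> nat \<Rightarrow> nat \<Rightarrow> 'p set \<Rightarrow> bool" where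
  "tight_set points lines I s x T \<longleftrightarrow>
     T \<subseteq> points \<and>
     (\<forall>p\<in>T. card (perp points lines I p \<inter> T) = s + x) \<and>
     (\<forall>p\<in>points - T. card (perp points lines I p \<inter> T) = x)"

text \<open>The incidence of a subquadrangle is the restriction of the ambient one to its
  own points and lines.\<close>

definition subquadrangle ::
    "'p set \<Rightarrow> 'l set \<Rightarrow> 'p set \<Rightarrow> 'l set \<Rightarrow> ('p \<Rightarrow> 'l \<Rightarrow> bool) \<Rightarrow> nat \<Rightarrow> nat \<Rightarrow> bool" where
  "subquadrangle points' lines' points lines I s' t' \<longleftrightarrow>
     points' \<subseteq> points \<and> lines' \<subseteq> lines \<and> generalised_quadrangle points' lines' I s' t'"

definition union_of_disjoint_lines ::
    "'p set \<Rightarrow> 'l set \<Rightarrow> ('p \<Rightarrow> 'l \<Rightarrow> bool) \<Rightarrow> nat \<Rightarrow> 'p set \<Rightarrow> bool" where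
  "union_of_disjoint_lines points lines I x T \<longleftrightarrow>
     (\<exists>M \<subseteq> lines. finite M \<and> card M = x \<and>
        (\<forall>l\<in>M. \<forall>m\<in>M. l \<noteq> m \<longrightarrow> points_on I points l \<inter> points_on I points m = {}) \<and>
        T = (\<Union>l\<in>M. points_on I points l))"

end

theory Submission
  imports Defs
begin

text \<open>
  Through a point \<open>N \<notin> \<T>\<close> no line carries more than \<open>|N\<^sup>\<bottom> \<inter> \<T>| = x\<close> points of \<open>\<T>\<close>, so a line
  with more than \<open>x\<close> such points lies in \<open>\<T>\<close>. On the other hand, a point \<open>P \<in> \<T>\<close> lies on
  \<open>t + 1\<close> lines which carry, counted with multiplicity, \<open>s + x + t \<ge> (t + 1) x\<close> points of \<open>\<T>\<close>.
  So either some line on \<open>P\<close> lies in \<open>\<T>\<close>, or \<open>x = s / t + 1\<close> and every line on \<open>P\<close> has exactly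
  \<open>x\<close> points in \<open>\<T>\<close>. The two kinds of points cannot both occur when \<open>x \<le> s\<close>: a line on a point
  of the second kind that misses a line \<open>\<ell> \<subseteq> \<T>\<close> has a point outside \<open>\<T>\<close>, and that point sees
  a further point of \<open>\<T>\<close> on \<open>\<ell>\<close>. If \<open>x = s + 1\<close>, then \<open>t = 1\<close> and every point is of the second kind.
\<close>

section \<open>Counting the points of a set along the lines on a point\<close>

context generalised_quadrangle
begin

lemma finite_points_on_line: "l \<in> lines \<Longrightarrow> finite (points_on I points l)"
  using card_points_on_line by (metis Suc_eq_plus1 card.infinite nat.distinct(1))

lemma finite_lines_on_point: "p \<in> points \<Longrightarrow> finite {l \<in> lines. I p l}"
  using card_lines_on_point by (metis Suc_eq_plus1 card.infinite nat.distinct(1))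

lemma perp_Int_eq:
  assumes "p \<in> T" "T \<subseteq> points"
  shows "perp points lines I p \<inter> T = insert p (\<Union>l\<in>{l \<in> lines. I p l}. points_on I T l - {p})"
  using assms unfolding perp_def points_on_def by auto

lemma finite_perp:
  assumes "p \<in> points"
  shows "finite (perp points lines I p)"
proof -
  have "perp points lines I p \<subseteq> insert p (\<Union>l\<in>{l \<in> lines. I p l}. points_on I points l)"
    unfolding perp_def points_on_def by auto
  moreover have "finite (\<Union>l\<in>{l \<in> lines. I p l}. points_on I points l)"
    using finite_lines_on_point[OF assms] by (rule finite_UN_I) (simp add: finite_points_on_line)
  ultimately show ?thesis by (simp add: finite_subset)
qed

lemma finite_points_on_subset: "l \<in> lines \<Longrightarrow> T \<subseteq> points \<Longrightarrow> finite (points_on I T l)"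
  using finite_points_on_line by (rule rev_finite_subset) (auto simp: points_on_def)

text \<open>Two lines on \<open>p\<close> share only \<open>p\<close>, so the sum counts every other
  point of \<open>T\<close> collinear with \<open>p\<close> once and \<open>p\<close> itself
  \<open>t + 1\<close> times; the excess is \<open>t\<close>.\<close>

lemma sum_card_points_on:
  assumes p: "p \<in> T" and T: "T \<subseteq> points"
  shows "(\<Sum>l | l \<in> lines \<and> I p l. card (points_on I T l)) = card (perp points lines I p \<inter> T) + t"
proof -
  let ?L = "{l \<in> lines. I p l}"
  have pp: "p \<in> points" using p T by auto
  have fL: "finite ?L" by (rule finite_lines_on_point[OF pp])
  have fl: "finite (points_on I T l)" if "l \<in> ?L" for l
    using finite_points_on_subset that T by auto
  have "card (\<Union>l\<in>?L. points_on I T l - {p}) = (\<Sum>l\<in>?L. card (points_on I T l - {p}))"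
  proof (rule card_UN_disjoint[OF fL])
    show "\<forall>l\<in>?L. \<forall>m\<in>?L. l \<noteq> m \<longrightarrow> (points_on I T l - {p}) \<inter> (points_on I T m - {p}) = {}"
      using common_line_unique[OF pp] T unfolding points_on_def by blast
  qed (use fl in auto)
  moreover have "finite (\<Union>l\<in>?L. points_on I T l - {p})" using fL fl by blast
  ultimately have "card (perp points lines I p \<inter> T) = Suc (\<Sum>l\<in>?L. card (points_on I T l - {p}))"
    unfolding perp_Int_eq[OF p T] by (subst card_insert_disjoint) auto
  moreover have "(\<Sum>l\<in>?L. card (points_on I T l)) = (\<Sum>l\<in>?L. card (points_on I T l - {p}) + 1)"
  proof (rule sum.cong[OF refl])
    fix l assume l: "l \<in> ?L"
    then have "p \<in> points_on I T l" using p by (auto simp: points_on_def)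
    then show "card (points_on I T l) = card (points_on I T l - {p}) + 1"
      using card.remove[OF fl[OF l]] by simp
  qed
  ultimately show ?thesis
    using card_lines_on_point[OF pp] by (simp add: sum_Suc)
qed

lemma projection:
  assumes "p \<in> points" "l \<in> lines" "\<not> I p l"
  obtains q m where "q \<in> points" "m \<in> lines" "I p m" "I q l" "I q m"
  using unique_projection[OF assms] by auto

lemma projection_unique:
  assumes "p \<in> points" "l \<in> lines" "\<not> I p l"
    and "q \<in> points" "m \<in> lines" "I p m" "I q l" "I q m"
    and "q' \<in> points" "m' \<in> lines" "I p m'" "I q' l" "I q' m'"
  shows "q = q' \<and> m = m'"
  using unique_projection[OF assms(1-3)] assms(4-) by blast

end

text \<open>The bound x \<le> s/t + 1 enters with its denominator cleared, which keeps all the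
  counting in the natural numbers.\<close>

locale gq_tight_set = generalised_quadrangle points lines I s t
  for points :: "'p set" and lines :: "'l set" and I s t +
  fixes x :: nat and T :: "'p set"
  assumes tight: "tight_set points lines I s x T"
    and t_mult_x_le: "t * x \<le> s + t"
begin

section \<open>Intersections of lines with a tight set\<close>

lemma T_subset: "T \<subseteq> points"
  using tight by (simp add: tight_set_def)

lemma card_perp_in: "p \<in> T \<Longrightarrow> card (perp points lines I p \<inter> T) = s + x"
  using tight by (simp add: tight_set_def)

lemma card_perp_out: "p \<in> points \<Longrightarrow> p \<notin> T \<Longrightarrow> card (perp points lines I p \<inter> T) = x"
  using tight by (simp add: tight_set_def)

lemma x_le: "x \<le> s + 1"
proof (rule ccontr)
  assume "\<not> x \<le> s + 1"
  then have "t * (s + 2) \<le> t * x" by (intro mult_le_mono2) simp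
  moreover have "s \<le> t * s" using t_ge_1 by simp
  ultimately show False using t_mult_x_le t_ge_1 by (simp add: mult.commute[of s])
qed

lemma card_points_on_le:
  assumes l: "l \<in> lines" and p: "p \<in> points" "p \<notin> T" "I p l"
  shows "card (points_on I T l) \<le> x"
proof -
  have "points_on I T l \<subseteq> perp points lines I p \<inter> T"
    using l p T_subset by (auto simp: points_on_def perp_def)
  then show ?thesis
    using card_mono finite_perp[OF p(1)] card_perp_out[OF p(1,2)] by (metis finite_Int)
qed

text \<open>A point outside \<open>T\<close> sees exactly \<open>x\<close> points of
  \<open>T\<close>; if one line on it already carries \<open>x\<close> of them, there are no
  others.\<close>

lemma perp_Int_eq_points_on:
  assumes l: "l \<in> lines" and p: "p \<in> points" "p \<notin> T" "I p l"
    and card: "card (points_on I T l) = x"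
  shows "perp points lines I p \<inter> T = points_on I T l"
proof -
  have "points_on I T l \<subseteq> perp points lines I p \<inter> T"
    using l p T_subset by (auto simp: points_on_def perp_def)
  then show ?thesis
    using card_subset_eq finite_perp[OF p(1)] card_perp_out[OF p(1,2)] card
    by (metis finite_Int)
qed

text \<open>The \<open>t + 1\<close> counts add up to \<open>s + x + t\<close>, which is at least
  \<open>(t + 1) * x\<close> by \<open>t_mult_x_le\<close>. If none exceeds \<open>x\<close>,
  equality holds throughout.\<close>

lemma all_lines_regular:
  assumes p: "p \<in> T"
    and le: "\<And>l. l \<in> lines \<Longrightarrow> I p l \<Longrightarrow> card (points_on I T l) \<le> x"
  shows "t * x = s + t"
    and "\<And>l. l \<in> lines \<Longrightarrow> I p l \<Longrightarrow> card (points_on I T l) = x"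
proof -
  let ?L = "{l \<in> lines. I p l}"
  have pp: "p \<in> points" using p T_subset by auto
  have eq: "(\<Sum>l\<in>?L. card (points_on I T l)) = s + x + t"
    using sum_card_points_on[OF p T_subset] card_perp_in[OF p] by simp
  have sx: "(\<Sum>l\<in>?L. x) = t * x + x"
    using card_lines_on_point[OF pp] by simp
  have "(\<Sum>l\<in>?L. card (points_on I T l)) \<le> (\<Sum>l\<in>?L. x)"
    by (rule sum_mono) (use le in auto)
  then show tx: "t * x = s + t" using eq sx t_mult_x_le by linarith
  show "card (points_on I T l) = x" if "l \<in> lines" "I p l" for l
  proof (rule ccontr)
    assume "card (points_on I T l) \<noteq> x"
    then have "card (points_on I T l) < x" using le that by force
    then have "(\<Sum>l\<in>?L. card (points_on I T l)) < (\<Sum>l\<in>?L. x)"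
      using finite_lines_on_point[OF pp] le that by (intro sum_strict_mono_ex1) auto
    then show False using eq sx tx by linarith
  qed
qed

section \<open>Points on no full line and the subquadrangle\<close>

definition full_lines :: "'l set" where
  "full_lines = {l \<in> lines. points_on I points l \<subseteq> T}"

lemma regular_or_full:
  assumes p: "p \<in> T" and nf: "\<And>l. l \<in> full_lines \<Longrightarrow> \<not> I p l"
  shows "t * x = s + t"
    and "\<And>l. l \<in> lines \<Longrightarrow> I p l \<Longrightarrow> card (points_on I T l) = x"
proof -
  have "card (points_on I T l) \<le> x" if l: "l \<in> lines" "I p l" for l
  proof -
    obtain q where "q \<in> points" "I q l" "q \<notin> T"
      using nf[of l] l by (auto simp: full_lines_def points_on_def)
    then show ?thesis using card_points_on_le l by blast
  qed
  then show "t * x = s + t" "\<And>l. l \<in> lines \<Longrightarrow> I p l \<Longrightarrow> card (points_on I T l) = x"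
    using all_lines_regular[OF p] by blast+
qed

text \<open>The counting axioms come from regularity and uniqueness is inherited; the point at issue
  is that projections of points of \<open>T\<close> stay in \<open>T\<close>.\<close>

lemma subquadrangle_if_regular:
  assumes ne: "T \<noteq> {}" and tx: "t * x = s + t"
    and reg: "\<And>p l. p \<in> T \<Longrightarrow> l \<in> lines \<Longrightarrow> I p l \<Longrightarrow> card (points_on I T l) = x"
  shows "subquadrangle T {l \<in> lines. card (points_on I T l) = x} points lines I (s div t) t"
    (is "subquadrangle T ?L _ _ _ _ _")
proof -
  have t0: "t > 0" using t_ge_1 by simp
  have "(s + t) div t = x" using tx t0 by (metis nonzero_mult_div_cancel_left less_not_refl)
  then have x: "x = s div t + 1" using t0 by simp
  have "s div t \<noteq> 0"
  proof
    assume "s div t = 0"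
    then have "t = s + t" using tx x by simp
    then show False using s_ge_1 by simp
  qed
  then have s': "s div t \<ge> 1" by simp
  have "generalised_quadrangle T ?L I (s div t) t"
  proof
    show "T \<noteq> {}" "s div t \<ge> 1" "t \<ge> 1" using ne s' t_ge_1 by auto
    show "l = m" if "p \<in> T" "q \<in> T" "p \<noteq> q" "l \<in> ?L" "m \<in> ?L" "I p l" "I q l" "I p m" "I q m"
      for p q l m
      using that common_line_unique T_subset by blast
    show "card (points_on I T l) = s div t + 1" if "l \<in> ?L" for l
      using that x by auto
    show "card {l \<in> ?L. I p l} = t + 1" if p: "p \<in> T" for p
    proof -
      have "{l \<in> ?L. I p l} = {l \<in> lines. I p l}" using reg[OF p] by auto
      then show ?thesis using card_lines_on_point p T_subset by auto
    qed
    show "\<exists>!(q, m). q \<in> T \<and> m \<in> ?L \<and> I p m \<and> I q l \<and> I q m"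
      if p: "p \<in> T" and l: "l \<in> ?L" and pl: "\<not> I p l" for p l
    proof -
      have pp: "p \<in> points" and ll: "l \<in> lines" using p l T_subset by auto
      obtain q m where qm: "q \<in> points" "m \<in> lines" "I p m" "I q l" "I q m"
        using projection[OF pp ll pl] .
      have "q \<in> T"
      \<comment> \<open>Outside \<open>T\<close>, the point \<open>q\<close> would see only the
        \<open>x\<close> points of \<open>T\<close> on \<open>l\<close>, yet it also sees
        \<open>p\<close>, which is not on \<open>l\<close>.\<close>
      proof (rule ccontr)
        assume "q \<notin> T"
        then have "perp points lines I q \<inter> T = points_on I T l"
          using perp_Int_eq_points_on ll qm l by blast
        moreover have "p \<in> perp points lines I q \<inter> T"
          using p pp qm by (auto simp: perp_def)
        ultimately show False using pl by (simp add: points_on_def)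
      qed
      have "m \<in> ?L" using reg[OF p] qm by auto
      show ?thesis
      proof (intro ex1I[of _ "(q, m)"])
        show "case (q, m) of (q, m) \<Rightarrow> q \<in> T \<and> m \<in> ?L \<and> I p m \<and> I q l \<and> I q m"
          using \<open>q \<in> T\<close> \<open>m \<in> ?L\<close> qm by simp
        fix z assume "case z of (q, m) \<Rightarrow> q \<in> T \<and> m \<in> ?L \<and> I p m \<and> I q l \<and> I q m"
        then have "fst z \<in> points" "snd z \<in> lines" "I p (snd z)" "I (fst z) l" "I (fst z) (snd z)"
          using T_subset by (auto split: prod.splits)
        then show "z = (q, m)"
          using projection_unique[OF pp ll pl qm] by (metis prod.collapse)
      qed
    qed
  qed
  then show ?thesis using T_subset by (auto simp: subquadrangle_def)
qed

text \<open>Two full lines meeting in \<open>p\<close> would show \<open>p\<close> at least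
  \<open>2 * s + 1\<close> points of \<open>T\<close>, more than the permitted \<open>s + x\<close>,
  which is at most \<open>2 * s\<close>.\<close>

lemma full_lines_disjoint:
  assumes x: "x \<le> s" and l: "l \<in> full_lines" and m: "m \<in> full_lines" and "l \<noteq> m"
  shows "points_on I points l \<inter> points_on I points m = {}"
proof (rule ccontr)
  assume "\<not> ?thesis"
  then obtain p where p: "p \<in> points_on I points l" "p \<in> points_on I points m" by auto
  let ?A = "points_on I points l" and ?B = "points_on I points m"
  have lm: "l \<in> lines" "m \<in> lines" "?A \<subseteq> T" "?B \<subseteq> T" using l m by (auto simp: full_lines_def)
  have fin: "finite ?A" "finite ?B" using finite_points_on_line lm by auto
  have "?A \<inter> ?B = {p}"
    using p common_line_unique lm \<open>l \<noteq> m\<close> unfolding points_on_def by blast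
  then have "card (?A \<union> ?B) = 2 * s + 1"
    using card_Un_Int[OF fin] card_points_on_line lm by simp
  moreover have "?A \<union> ?B \<subseteq> perp points lines I p \<inter> T"
    using p lm unfolding points_on_def perp_def by auto
  moreover have pT: "p \<in> T" "p \<in> points" using p lm by (auto simp: points_on_def)
  ultimately have "2 * s + 1 \<le> s + x"
    using card_mono[of "perp points lines I p \<inter> T" "?A \<union> ?B"] finite_perp card_perp_in by auto
  then show False using x by simp
qed

lemma full_line_on_every_point:
  assumes l: "l \<in> full_lines" and p: "p \<in> T"
  shows "\<exists>m\<in>full_lines. I p m"
proof (rule ccontr)
  assume "\<not> ?thesis"
  then have nf: "\<And>m. m \<in> full_lines \<Longrightarrow> \<not> I p m" by blast
  have ll: "l \<in> lines" using l by (simp add: full_lines_def)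
  have pp: "p \<in> points" using p T_subset by auto
  have pl: "\<not> I p l" using nf l by blast
  obtain r m where rm: "r \<in> points" "m \<in> lines" "I p m" "I r l" "I r m"
    using projection[OF pp ll pl] .
  \<comment> \<open>Since \<open>t + 1\<close> is at least 2, there is a line \<open>n\<close> on
    \<open>p\<close> besides \<open>m\<close>. It misses \<open>l\<close>, because \<open>m\<close>
    is the only line on \<open>p\<close> that meets \<open>l\<close>.\<close>
  have "{m' \<in> lines. I p m'} \<noteq> {m}"
    using card_lines_on_point[OF pp] t_ge_1 by auto
  then obtain n where n: "n \<in> lines" "I p n" "n \<noteq> m" using rm by blast
  have disj: "\<not> I q n" if "q \<in> points" "I q l" for q
    using projection_unique[OF pp ll pl rm] that n by blast
  obtain N where N: "N \<in> points" "I N n" "N \<notin> T"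
    using nf[of n] n by (auto simp: full_lines_def points_on_def)
  \<comment> \<open>The projection \<open>q\<close> of \<open>N\<close> onto \<open>l\<close> lies
    in \<open>T\<close>. As \<open>n\<close> already carries all the points of \<open>T\<close> that
    \<open>N\<close> sees, \<open>q\<close> would lie on \<open>n\<close> as well.\<close>
  have "\<not> I N l" using disj N by blast
  then obtain q k where q: "q \<in> points" "k \<in> lines" "I N k" "I q l" "I q k"
    using projection[OF N(1) ll] by blast
  have "q \<in> T" using q l by (auto simp: full_lines_def points_on_def)
  then have "q \<in> perp points lines I N \<inter> T" using q by (auto simp: perp_def)
  moreover have "perp points lines I N \<inter> T = points_on I T n"
    using perp_Int_eq_points_on n N regular_or_full(2)[OF p nf] by blast
  ultimately show False using disj q by (simp add: points_on_def)
qed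

text \<open>If \<open>T\<close> contained all points, every line would be full, although two lines
  on a common point are not disjoint.\<close>

lemma exists_point_outside:
  assumes x: "x \<le> s"
  shows "\<exists>q\<in>points. q \<notin> T"
proof (rule ccontr)
  assume "\<not> ?thesis"
  then have T: "points \<subseteq> T" by auto
  obtain p where p: "p \<in> points" using points_nonempty by auto
  have "\<not> card {l \<in> lines. I p l} \<le> Suc 0"
    using card_lines_on_point[OF p] t_ge_1 by simp
  then obtain l m where "l \<in> lines" "I p l" "m \<in> lines" "I p m" "l \<noteq> m"
    using card_le_Suc0_iff_eq[OF finite_lines_on_point[OF p]] by blast
  then show False
    using full_lines_disjoint[OF x, of l m] p T by (auto simp: full_lines_def points_on_def)
qed

text \<open>Covering and disjointness already exhibit \<open>T\<close> as a union of lines; what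
  remains is that there are exactly \<open>x\<close> of them.\<close>

lemma union_of_full_lines:
  assumes x: "x \<le> s" and cover: "\<And>p. p \<in> T \<Longrightarrow> \<exists>l\<in>full_lines. I p l"
  shows "union_of_disjoint_lines points lines I x T"
proof -
  obtain q where q: "q \<in> points" "q \<notin> T" using exists_point_outside[OF x] by auto
  have unique: "l = m" if "l \<in> full_lines" "m \<in> full_lines" "p \<in> points" "I p l" "I p m" for p l m
    using full_lines_disjoint[OF x that(1,2)] that by (auto simp: points_on_def)
  text \<open>The \<open>x\<close> points of \<open>T\<close> seen from \<open>q\<close> are its projections onto the full lines.\<close>
  define f where "f p = (THE l. l \<in> full_lines \<and> I p l)" for p
  have f: "f p = l" if "l \<in> full_lines" "p \<in> points" "I p l" for p l
    unfolding f_def using that unique by blast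
  have qn: "\<not> I q l" if "l \<in> full_lines" for l
    using that q by (auto simp: full_lines_def points_on_def)
  have bij: "bij_betw f (perp points lines I q \<inter> T) full_lines"
  proof (rule bij_betw_imageI)
    show "inj_on f (perp points lines I q \<inter> T)"
    proof (rule inj_onI)
      fix a b assume ab: "a \<in> perp points lines I q \<inter> T" "b \<in> perp points lines I q \<inter> T"
        and eq: "f a = f b"
      have P: "a \<in> points" "b \<in> points" using ab T_subset by auto
      obtain l m where lm: "l \<in> full_lines" "I a l" "m \<in> full_lines" "I b m"
        using cover ab by blast
      then have "I b l" using eq f P by auto
      moreover obtain k k' where "k \<in> lines" "I q k" "I a k" "k' \<in> lines" "I q k'" "I b k'"
        using ab q by (auto simp: perp_def)
      moreover have "l \<in> lines" using lm by (simp add: full_lines_def)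
      \<comment> \<open>Both \<open>a\<close> and \<open>b\<close> are projections of
        \<open>q\<close> onto the same full line \<open>l\<close>.\<close>
      ultimately show "a = b"
        using projection_unique[OF q(1) _ qn] lm P by blast
    qed
    show "f ` (perp points lines I q \<inter> T) = full_lines"
    proof (intro equalityI subsetI)
      fix l assume "l \<in> f ` (perp points lines I q \<inter> T)"
      then show "l \<in> full_lines" using cover f T_subset by blast
    next
      fix l assume l: "l \<in> full_lines"
      then have ll: "l \<in> lines" by (simp add: full_lines_def)
      obtain r m where rm: "r \<in> points" "m \<in> lines" "I q m" "I r l" "I r m"
        using projection[OF q(1) ll qn[OF l]] .
      then have "r \<in> perp points lines I q \<inter> T"
        using l by (auto simp: perp_def full_lines_def points_on_def)
      then show "l \<in> f ` (perp points lines I q \<inter> T)" using f[OF l rm(1,4)] by force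
    qed
  qed
  have "finite full_lines" "card full_lines = x"
    using bij bij_betw_finite bij_betw_same_card finite_perp q card_perp_out by fastforce+
  moreover have "T = (\<Union>l\<in>full_lines. points_on I points l)"
    using cover T_subset by (auto simp: full_lines_def points_on_def)
  moreover have "full_lines \<subseteq> lines" by (auto simp: full_lines_def)
  ultimately show ?thesis
    unfolding union_of_disjoint_lines_def using full_lines_disjoint[OF x]
    by (intro exI[of _ full_lines] conjI ballI impI)
qed

section \<open>Combination of the cases\<close>

lemma dichotomy:
  "union_of_disjoint_lines points lines I x T \<or>
    (t * x = s + t \<and>
     subquadrangle T {l \<in> lines. card (points_on I T l) = x} points lines I (s div t) t)"
proof (cases "x \<le> s")
  case True
  show ?thesis
  proof (cases "\<forall>p\<in>T. \<exists>l\<in>full_lines. I p l")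
    case True
    \<comment> \<open>This branch includes empty \<open>T\<close>, as the union of no lines.\<close>
    then show ?thesis using union_of_full_lines[OF \<open>x \<le> s\<close>] by blast
  next
    case False
    then obtain p where p: "p \<in> T" and pf: "\<And>l. l \<in> full_lines \<Longrightarrow> \<not> I p l" by blast
    \<comment> \<open>A single full line would put one on every point of \<open>T\<close>, including
      \<open>p\<close>; so no point of \<open>T\<close> lies on one, and all are regular.\<close>
    have "full_lines = {}" using full_line_on_every_point[OF _ p] pf by blast
    then have "card (points_on I T l) = x" if "q \<in> T" "l \<in> lines" "I q l" for q l
      using regular_or_full(2) that by blast
    then show ?thesis
      using p regular_or_full(1)[OF p pf] subquadrangle_if_regular by blast
  qed
next
  case False
  then have x: "x = s + 1" using x_le by simp
  \<comment> \<open>Here the bound is merely the size \<open>s + 1\<close> of a line, so it holds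
    for full lines too.\<close>
  have le: "card (points_on I T l) \<le> x" if "l \<in> lines" for l
  proof -
    have "points_on I T l \<subseteq> points_on I points l" using T_subset by (auto simp: points_on_def)
    then show ?thesis
      using card_mono[OF finite_points_on_line[OF that]] card_points_on_line[OF that] x by simp
  qed
  \<comment> \<open>With \<open>T\<close> empty, any point would see \<open>x = s + 1\<close> points
    of the empty set.\<close>
  have "T \<noteq> {}" using card_perp_out points_nonempty x by fastforce
  then obtain p where p: "p \<in> T" by blast
  have "card (points_on I T l) = x" if "q \<in> T" "l \<in> lines" "I q l" for q l
    using all_lines_regular(2) le that by blast
  then show ?thesis
    using p all_lines_regular(1)[OF p le] subquadrangle_if_regular by blast
qed

end

theorem theorem5p7:
  fixes points :: "'p set" and lines :: "'l set" and I :: "'p \<Rightarrow> 'l \<Rightarrow> bool"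
    and s t x :: nat and T :: "'p set"
  assumes "generalised_quadrangle points lines I s t"
    and "s \<ge> t"
    and "tight_set points lines I s x T"
    and "real x \<le> real s / real t + 1"
  shows "union_of_disjoint_lines points lines I x T \<or>
    (real x = real s / real t + 1 \<and> t dvd s \<and>
     subquadrangle T {l \<in> lines. card (points_on I T l) = x} points lines I (s div t) t)"
proof -
  interpret generalised_quadrangle points lines I s t by fact
  have t: "real t > 0" using t_ge_1 by simp
  have "real (t * x) \<le> real (s + t)"
    using assms(4) t by (simp add: field_simps)
  then have "t * x \<le> s + t" by (simp only: of_nat_le_iff)
  then interpret gq_tight_set points lines I s t x T
    by unfold_locales (use assms(3) in auto)
  \<comment> \<open>Divisibility makes \<open>s div t\<close> in the order of the subquadrangle the
    exact quotient s/t.\<close>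
  have "real x = real s / real t + 1 \<and> t dvd s" if tx: "t * x = s + t"
  proof
    have "real t * real x = real s + real t"
      using tx by (metis of_nat_add of_nat_mult)
    then show "real x = real s / real t + 1" using t by (simp add: field_simps)
    show "t dvd s" using tx by (metis dvd_add_left_iff dvd_refl dvd_triv_left)
  qed
  then show ?thesis using dichotomy by blast
qed

end
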